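(* Let $\mathcal{C}$ be a class of finite groups closed under taking subgroups and finite direct products. If $G$ is a $\mathcal{C}$-Grossmanian group then $G$ is $\mathcal{C}$-IAS.
   Context: Classes of groups are understood to be closed under isomorphism. A group $G$ is $\mathcal{C}$-conjugacy separable ($\mathcal{C}$-CS) if for all $f,g\in G$ that are not conjugate in $G$ there are a group $F \in \mathcal{C}$ and a homomorphism $\phi\colon G\to F$ such that $\phi(f)$ and $\phi(g)$ are not conjugate in $F$. A group $G$ has Grossman's property (A) if every pointwise inner automorphism of $G$ (i.e. every $\phi \in \operatorname{Aut}(G)$ such that $\phi(g)$ is conjugate to $g$ for every $g \in G$) is inner. A group is $\mathcal{C}$-Grossmanian if it is finitely generated, $\mathcal{C}$-CS and has Grossman's property (A). A group $G$ is $\mathcal{C}$-inner automorphism separable ($\mathcal{C}$-IAS) if for every $\phi \in \operatorname{Aut}(G)\setminus\operatorname{Inn}(G)$ there is a characteristic subgroup $K$ of $G$ with $G/K\in\mathcal{C}$ such that $\tilde{\kappa}(\phi)\notin \operatorname{Inn}(G/K)$, where $\tilde{\kappa}\colon\operatorname{Aut}(G)\to\operatorname{Aut}(G/K)$ is given by $\tilde{\kappa}(\psi)(gK) = \psi(g)K$. *)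

theory Defs
  imports "HOL-Algebra.Algebra"
begin

text \<open>
  A class of finite groups closed under isomorphism is represented by its members whose
  elements are natural numbers: every finite group is isomorphic to such a group, so nothing is
  lost. A group over an arbitrary type is a member if it is isomorphic to one of these.
\<close>

definition finite_group_class :: "nat monoid set \<Rightarrow> bool" where
  "finite_group_class \<C> \<longleftrightarrow>
     (\<forall>F\<in>\<C>. group F \<and> finite (carrier F)) \<and>
     (\<forall>F\<in>\<C>. \<forall>F' :: nat monoid. group F' \<and> F \<cong> F' \<longrightarrow> F' \<in> \<C>)"

definition in_class :: "nat monoid set \<Rightarrow> ('a, 'b) monoid_scheme \<Rightarrow> bool" where
  "in_class \<C> G \<longleftrightarrow> group G \<and> (\<exists>F\<in>\<C>. G \<cong> F)"

lemma in_class_iff_mem: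
  assumes "finite_group_class \<C>"
  shows "in_class \<C> (F :: nat monoid) \<longleftrightarrow> F \<in> \<C>"
proof
  assume "in_class \<C> F"
  then obtain F' where "group F" "F' \<in> \<C>" "F \<cong> F'" by (auto simp: in_class_def)
  moreover from this have "F' \<cong> F" using group.iso_sym by blast
  ultimately show "F \<in> \<C>" using assms unfolding finite_group_class_def by blast
next
  assume "F \<in> \<C>"
  then show "in_class \<C> F"
    using assms iso_refl[of F] unfolding finite_group_class_def in_class_def by blast
qed

definition subgroup_closed :: "nat monoid set \<Rightarrow> bool" where
  "subgroup_closed \<C> \<longleftrightarrow>
     (\<forall>F\<in>\<C>. \<forall>H. subgroup H F \<longrightarrow> in_class \<C> (F\<lparr>carrier := H\<rparr>))"

text \<open>
  Only products of nonempty families are considered, so the empty class is not excluded; for a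
  nonempty class closed under subgroups the empty product is a member anyway.
\<close>

definition finite_product_closed :: "nat monoid set \<Rightarrow> bool" where
  "finite_product_closed \<C> \<longleftrightarrow>
     (\<forall>(I :: nat set) F. finite I \<and> I \<noteq> {} \<and> (\<forall>i\<in>I. F i \<in> \<C>)
        \<longrightarrow> in_class \<C> (product_group I F))"

definition conjugate_in :: "('a, 'b) monoid_scheme \<Rightarrow> 'a \<Rightarrow> 'a \<Rightarrow> bool" where
  "conjugate_in G f g \<longleftrightarrow> (\<exists>h\<in>carrier G. g = h \<otimes>\<^bsub>G\<^esub> f \<otimes>\<^bsub>G\<^esub> inv\<^bsub>G\<^esub> h)"

definition conjugacy_separable :: "nat monoid set \<Rightarrow> ('a, 'b) monoid_scheme \<Rightarrow> bool" where
  "conjugacy_separable \<C> G \<longleftrightarrow>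
     (\<forall>f\<in>carrier G. \<forall>g\<in>carrier G. \<not> conjugate_in G f g \<longrightarrow>
        (\<exists>F\<in>\<C>. \<exists>\<phi>\<in>hom G F. \<not> conjugate_in F (\<phi> f) (\<phi> g)))"

definition Inn :: "('a, 'b) monoid_scheme \<Rightarrow> ('a \<Rightarrow> 'a) set" where
  "Inn G = {\<lambda>x\<in>carrier G. h \<otimes>\<^bsub>G\<^esub> x \<otimes>\<^bsub>G\<^esub> inv\<^bsub>G\<^esub> h | h. h \<in> carrier G}"

definition pointwise_inner :: "('a, 'b) monoid_scheme \<Rightarrow> ('a \<Rightarrow> 'a) \<Rightarrow> bool" where
  "pointwise_inner G \<phi> \<longleftrightarrow> \<phi> \<in> auto G \<and> (\<forall>g\<in>carrier G. conjugate_in G (\<phi> g) g)"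

definition grossman_property_A :: "('a, 'b) monoid_scheme \<Rightarrow> bool" where
  "grossman_property_A G \<longleftrightarrow> (\<forall>\<phi>. pointwise_inner G \<phi> \<longrightarrow> \<phi> \<in> Inn G)"

definition finitely_generated_group :: "('a, 'b) monoid_scheme \<Rightarrow> bool" where
  "finitely_generated_group G \<longleftrightarrow>
     (\<exists>S. finite S \<and> S \<subseteq> carrier G \<and> generate G S = carrier G)"

definition grossmanian :: "nat monoid set \<Rightarrow> ('a, 'b) monoid_scheme \<Rightarrow> bool" where
  "grossmanian \<C> G \<longleftrightarrow>
     group G \<and> finitely_generated_group G \<and> conjugacy_separable \<C> G \<and> grossman_property_A G"

definition characteristic_subgroup :: "'a set \<Rightarrow> ('a, 'b) monoid_scheme \<Rightarrow> bool" where
  "characteristic_subgroup K G \<longleftrightarrow> subgroup K G \<and> (\<forall>\<phi>\<in>auto G. \<phi> ` K = K)"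

text \<open>
  The union ranges over all representatives of the coset \<open>A\<close>. For characteristic \<open>K\<close> it does not
  depend on the representative; see \<open>induced_aut_coset\<close>.
\<close>

definition induced_aut ::
    "('a, 'b) monoid_scheme \<Rightarrow> 'a set \<Rightarrow> ('a \<Rightarrow> 'a) \<Rightarrow> 'a set \<Rightarrow> 'a set" where
  "induced_aut G K \<psi> = (\<lambda>A\<in>carrier (G Mod K). \<Union>x\<in>A. K #>\<^bsub>G\<^esub> \<psi> x)"

definition inner_aut_separable :: "nat monoid set \<Rightarrow> ('a, 'b) monoid_scheme \<Rightarrow> bool" where
  "inner_aut_separable \<C> G \<longleftrightarrow>
     (\<forall>\<phi>\<in>auto G - Inn G.
        \<exists>K. characteristic_subgroup K G \<and> in_class \<C> (G Mod K) \<and>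
            induced_aut G K \<phi> \<notin> Inn (G Mod K))"

lemma (in group) Inn_subset_auto: "Inn G \<subseteq> auto G"
proof
  fix \<phi> assume "\<phi> \<in> Inn G"
  then obtain h where h: "h \<in> carrier G" and \<phi>: "\<phi> = (\<lambda>x\<in>carrier G. h \<otimes> x \<otimes> inv h)"
    by (auto simp: Inn_def)
  have "\<phi> \<in> Bij (carrier G)"
    using h conjugation_is_bij[OF h] by (simp add: \<phi> Bij_def)
  moreover have "\<phi> \<in> hom G G"
  proof (rule homI)
    fix x y assume xy: "x \<in> carrier G" "y \<in> carrier G"
    have "inv h \<otimes> (h \<otimes> (y \<otimes> inv h)) = y \<otimes> inv h"
      using h xy by (metis inv_closed l_inv l_one m_assoc m_closed)
    then show "\<phi> (x \<otimes> y) = \<phi> x \<otimes> \<phi> y"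
      using h xy by (simp add: \<phi> m_assoc)
  qed (use h in \<open>simp add: \<phi>\<close>)
  ultimately show "\<phi> \<in> auto G" by (simp add: auto_def)
qed

lemma (in group) characteristic_imp_normal:
  assumes "characteristic_subgroup K G"
  shows "K \<lhd> G"
proof -
  have K: "subgroup K G" using assms by (simp add: characteristic_subgroup_def)
  have "x \<otimes> k \<otimes> inv x \<in> K" if "x \<in> carrier G" "k \<in> K" for x k
  proof -
    have "(\<lambda>y\<in>carrier G. x \<otimes> y \<otimes> inv x) \<in> auto G"
      using Inn_subset_auto that by (auto simp: Inn_def)
    then have "(\<lambda>y\<in>carrier G. x \<otimes> y \<otimes> inv x) ` K = K"
      using assms unfolding characteristic_subgroup_def by blast
    moreover have "k \<in> carrier G" using K that subgroup.mem_carrier by metis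
    ultimately have "(\<lambda>y\<in>carrier G. x \<otimes> y \<otimes> inv x) k \<in> K" using that by blast
    then show ?thesis using \<open>k \<in> carrier G\<close> by simp
  qed
  then show ?thesis using K normal_inv_iff by blast
qed

lemma (in group) induced_aut_coset:
  assumes "characteristic_subgroup K G" "\<psi> \<in> auto G" "g \<in> carrier G"
  shows "induced_aut G K \<psi> (K #> g) = K #> \<psi> g"
proof -
  have K: "subgroup K G" using assms by (simp add: characteristic_subgroup_def)
  have hom: "\<psi> \<in> hom G G" using assms by (simp add: auto_def)
  have \<psi>g: "\<psi> g \<in> carrier G" using hom assms by (auto simp: hom_def)
  have const: "K #> \<psi> x = K #> \<psi> g" if x: "x \<in> K #> g" for x
  proof -
    obtain k where k: "k \<in> K" "x = k \<otimes> g" using x by (auto simp: r_coset_def)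
    have kc: "k \<in> carrier G" using K k subgroup.mem_carrier by metis
    have "\<psi> k \<in> K" using assms k by (auto simp: characteristic_subgroup_def)
    moreover have "\<psi> x = \<psi> k \<otimes> \<psi> g" using hom_mult[OF hom kc assms(3)] k by simp
    ultimately have "\<psi> x \<in> K #> \<psi> g" by (auto simp: r_coset_def)
    then show ?thesis using repr_independence[OF _ \<psi>g K] by simp
  qed
  have "g \<in> K #> g" using rcos_self[OF assms(3) K] .
  then have "(\<Union>x\<in>K #> g. K #> \<psi> x) = K #> \<psi> g" using const by blast
  moreover have "K #> g \<in> carrier (G Mod K)"
    using assms(3) K by (auto simp: FactGroup_def RCOSETS_def)
  ultimately show ?thesis by (simp only: induced_aut_def restrict_apply if_True)
qed

end

theory Submission
  imports Defs
begin

text \<open>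
  A non-inner automorphism \<open>\<phi>\<close> is not pointwise inner by property (A), so some \<open>\<phi>(g)\<close> is not
  conjugate to \<open>g\<close>, and this is witnessed by a homomorphism \<open>\<pi>\<close> to some \<open>F\<close> in \<open>\<C>\<close>. Take for
  \<open>K\<close> the intersection of the kernels of \<^emph>\<open>all\<close> homomorphisms from \<open>G\<close> to \<open>F\<close>. Automorphisms of
  \<open>G\<close> permute these homomorphisms, so \<open>K\<close> is characteristic; there are only finitely many of them,
  because \<open>G\<close> is finitely generated, so \<open>G/K\<close> embeds into a finite power of \<open>F\<close>. As \<open>\<pi>\<close> factors
  through \<open>G/K\<close>, the automorphism induced by \<open>\<phi>\<close> on \<open>G/K\<close> is not inner.
\<close>

lemma (in group) conjugate_in_sym:
  assumes "f \<in> carrier G" "conjugate_in G f g"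
  shows "conjugate_in G g f"
proof -
  obtain h where h: "h \<in> carrier G" "g = h \<otimes> f \<otimes> inv h"
    using assms(2) by (auto simp: conjugate_in_def)
  have "f = inv h \<otimes> g \<otimes> inv (inv h)"
    using h assms(1) by (simp add: m_assoc inv_solve_left inv_solve_right)
  then show ?thesis using h(1) unfolding conjugate_in_def by blast
qed

lemma hom_eq_on_generate:
  assumes "group_hom G H f" "group_hom G H f'" "S \<subseteq> carrier G"
    and "\<And>s. s \<in> S \<Longrightarrow> f s = f' s" and "x \<in> generate G S"
  shows "f x = f' x"
proof -
  interpret f: group_hom G H f by fact
  interpret f': group_hom G H f' by fact
  show ?thesis using assms(5)
  proof induction
    case (inv s)
    then show ?case using assms(3,4) by auto
  next
    case (eng x y)
    then show ?case using f.G.generate_in_carrier[OF assms(3)] by simp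
  qed (use assms(4) in auto)
qed

text \<open>A homomorphism is determined by its values on a finite generating set \<open>S\<close>,
  so restriction to \<open>S\<close> embeds the set into the finite set
  \<open>S \<rightarrow>\<^sub>E carrier H\<close>. Intersecting with
  \<open>extensional (carrier G)\<close> discards the arbitrary values off the carrier, which could
  make \<open>hom G H\<close> itself infinite.\<close>

lemma finite_extensional_hom:
  assumes "group G" "finitely_generated_group G" "group H" "finite (carrier H)"
  shows "finite (hom G H \<inter> extensional (carrier G))"
proof -
  obtain S where S: "finite S" "S \<subseteq> carrier G" "generate G S = carrier G"
    using assms(2) by (auto simp: finitely_generated_group_def)
  have "inj_on (\<lambda>f. restrict f S) (hom G H \<inter> extensional (carrier G))"
  proof (rule inj_onI)
    fix f f' assume f: "f \<in> hom G H \<inter> extensional (carrier G)"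
      and f': "f' \<in> hom G H \<inter> extensional (carrier G)" and eq: "restrict f S = restrict f' S"
    have "f s = f' s" if "s \<in> S" for s using fun_cong[OF eq, of s] that by simp
    then have "f x = f' x" if "x \<in> carrier G" for x
      using hom_eq_on_generate[of G H f f' S x] S f f' that assms(1,3)
      by (auto simp: group_hom_def group_hom_axioms_def)
    then show "f = f'" using f f' by (auto intro: extensionalityI)
  qed
  moreover have "(\<lambda>f. restrict f S) ` (hom G H \<inter> extensional (carrier G)) \<subseteq> S \<rightarrow>\<^sub>E carrier H"
    using S(2) by (force simp: hom_def)
  ultimately show ?thesis
    using finite_PiE[OF S(1), of "\<lambda>_. carrier H"] assms(4) finite_subset finite_imageD by metis
qed

text \<open>Only values on the carrier enter, so for a group \<open>G\<close> the extensional
  homomorphisms alone cut out the same set.\<close>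

definition hom_core :: "('a, 'b) monoid_scheme \<Rightarrow> ('c, 'd) monoid_scheme \<Rightarrow> 'a set" where
  "hom_core G F = {x \<in> carrier G. \<forall>f\<in>hom G F. f x = \<one>\<^bsub>F\<^esub>}"

lemma subgroup_hom_core:
  assumes "group G" "group F"
  shows "subgroup (hom_core G F) G"
proof -
  interpret group G by fact
  \<comment> \<open>The trivial homomorphism makes this family of kernels nonempty, so that the
    intersection stays inside the carrier.\<close>
  have "hom_core G F = (\<Inter>f\<in>hom G F. kernel G F f)"
    using trivial_hom[OF assms(2), of G] by (auto simp: hom_core_def kernel_def)
  moreover have "subgroup (kernel G F f) G" if "f \<in> hom G F" for f
    using group_hom.subgroup_kernel[of G F f] assms that
    by (simp add: group_hom_def group_hom_axioms_def)
  ultimately show ?thesis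
    using subgroups_Inter[of "kernel G F ` hom G F"] trivial_hom[OF assms(2), of G] by auto
qed

text \<open>Precomposing a homomorphism to \<open>F\<close> with an endomorphism of \<open>G\<close>
  gives a homomorphism to \<open>F\<close> again, so every endomorphism maps the core into itself.
  For an automorphism, the same applied to its inverse gives equality.\<close>

lemma characteristic_hom_core:
  assumes "group G" "group F"
  shows "characteristic_subgroup (hom_core G F) G"
proof -
  \<comment> \<open>Stated for all of \<open>hom G G\<close> because
    \<open>inv_into (carrier G) \<phi>\<close>, to which it is applied below, need not be
    extensional as members of \<open>auto G\<close> are.\<close>
  have sub: "\<phi> ` hom_core G F \<subseteq> hom_core G F" if "\<phi> \<in> hom G G" for \<phi>
  proof safe
    fix x assume x: "x \<in> hom_core G F"
    have "f (\<phi> x) = \<one>\<^bsub>F\<^esub>" if "f \<in> hom G F" for f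
      using x Group.hom_compose[OF \<open>\<phi> \<in> hom G G\<close> that] by (force simp: hom_core_def)
    then show "\<phi> x \<in> hom_core G F"
      using x hom_in_carrier[OF \<open>\<phi> \<in> hom G G\<close>] by (simp add: hom_core_def)
  qed
  have "\<phi> ` hom_core G F = hom_core G F" if \<phi>: "\<phi> \<in> auto G" for \<phi>
  proof
    have "\<phi> \<in> iso G G" using \<phi> by (simp add: auto_def iso_def Bij_def)
    then have inv: "inv_into (carrier G) \<phi> \<in> hom G G"
      using group.iso_set_sym[OF assms(1)] by (auto simp: iso_def)
    have surj: "\<phi> ` carrier G = carrier G"
      using \<phi> by (auto simp: auto_def Bij_def bij_betw_def)
    show "hom_core G F \<subseteq> \<phi> ` hom_core G F"
    proof
      fix y assume y: "y \<in> hom_core G F"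
      then have "\<phi> (inv_into (carrier G) \<phi> y) = y"
        using surj by (auto simp: hom_core_def intro: f_inv_into_f)
      then show "y \<in> \<phi> ` hom_core G F" using sub[OF inv] y by (metis imageI subsetD)
    qed
    show "\<phi> ` hom_core G F \<subseteq> hom_core G F" using sub \<phi> by (simp add: auto_def)
  qed
  then show ?thesis using subgroup_hom_core[OF assms] by (simp add: characteristic_subgroup_def)
qed

lemma in_class_iso:
  assumes "in_class \<C> H" "group G" "G \<cong> H"
  shows "in_class \<C> G"
  using assms iso_trans by (auto simp: in_class_def)

text \<open>Carries \<open>subgroup_closed\<close>, which speaks of groups on the naturals, along an
  isomorphism to groups on any type, such as products, whose elements are functions.\<close>

lemma in_class_subgroup:
  assumes "finite_group_class \<C>" "subgroup_closed \<C>" "in_class \<C> P" "subgroup H P"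
  shows "in_class \<C> (P\<lparr>carrier := H\<rparr>)"
proof -
  obtain F \<psi> where F: "F \<in> \<C>" "\<psi> \<in> iso P F" and "group P"
    using assms(3) by (auto simp: in_class_def is_iso_def)
  interpret P: group P by fact
  have "group F" using assms(1) F(1) by (simp add: finite_group_class_def)
  have \<psi>: "group_hom P F \<psi>"
    using F(2) \<open>group P\<close> \<open>group F\<close> by (auto simp: group_hom_def group_hom_axioms_def iso_def)
  have "subgroup (\<psi> ` H) F" using group_hom.subgroup_img_is_subgroup[OF \<psi> assms(4)] .
  then have "in_class \<C> (F\<lparr>carrier := \<psi> ` H\<rparr>)"
    using assms(2) F(1) by (simp add: subgroup_closed_def)
  moreover have "\<psi> \<in> iso (P\<lparr>carrier := H\<rparr>) (F\<lparr>carrier := \<psi> ` H\<rparr>)"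
    using F(2) subgroup.subset[OF assms(4)]
    by (auto simp: iso_def hom_def bij_betw_def subset_iff intro: inj_on_subset)
  ultimately show ?thesis
    using in_class_iso is_isoI P.subgroup_imp_group[OF assms(4)] by blast
qed

text \<open>By the first isomorphism theorem the quotient is isomorphic to the image of
  \<open>\<theta>\<close>, a subgroup of \<open>P\<close>.\<close>

lemma in_class_factor_kernel:
  assumes "finite_group_class \<C>" "subgroup_closed \<C>" "in_class \<C> P" "group_hom G P \<theta>"
  shows "in_class \<C> (G Mod kernel G P \<theta>)"
proof -
  interpret \<theta>: group_hom G P \<theta> by fact
  let ?I = "P\<lparr>carrier := \<theta> ` carrier G\<rparr>"
  have I: "in_class \<C> ?I" using in_class_subgroup[OF assms(1-3) \<theta>.img_is_subgroup] .
  \<comment> \<open>Shrinking the codomain to the image makes \<open>\<theta>\<close> surjective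
    without changing its kernel.\<close>
  have "group_hom G ?I \<theta>"
    using I \<theta>.homh \<theta>.G.group_axioms
    by (auto simp: group_hom_def group_hom_axioms_def in_class_def hom_def)
  then have "G Mod kernel G ?I \<theta> \<cong> ?I" by (rule group_hom.FactGroup_iso) simp
  moreover have "kernel G ?I \<theta> = kernel G P \<theta>" by (simp add: kernel_def)
  moreover have "group (G Mod kernel G P \<theta>)"
    using normal.factorgroup_is_group[OF \<theta>.normal_kernel] .
  ultimately show ?thesis using in_class_iso[OF I] by simp
qed

lemma in_class_factor_hom_core:
  assumes "finite_group_class \<C>" "subgroup_closed \<C>" "finite_product_closed \<C>"
    and "F \<in> \<C>" "group G" "finitely_generated_group G"
  shows "in_class \<C> (G Mod hom_core G F)"
proof -
  interpret G: group G by fact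
  have F: "group F" "finite (carrier F)" using assms(1,4) by (auto simp: finite_group_class_def)
  interpret F: group F by fact
  define E where "E = hom G F \<inter> extensional (carrier G)"
  have "finite E" unfolding E_def using finite_extensional_hom assms(5,6) F by blast
  \<comment> \<open>Enumerated by naturals because \<open>finite_product_closed\<close> takes index
    sets of that type.\<close>
  then obtain n :: nat and e where e: "E = e ` {i. i < n}"
    using finite_imp_nat_seg_image_inj_on by metis
  let ?I = "{i. i < n}"
  have restr: "restrict f (carrier G) \<in> E" if "f \<in> hom G F" for f
    using that by (auto simp: E_def hom_def)
  \<comment> \<open>The trivial homomorphism forces \<open>n > 0\<close>; product closure covers
    only nonempty families.\<close>
  have "(\<lambda>x\<in>carrier G. \<one>\<^bsub>F\<^esub>) \<in> E" by (auto simp: E_def hom_def)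
  then have "?I \<noteq> {}" using e by auto
  let ?P = "product_group ?I (\<lambda>_. F)"
  have P: "in_class \<C> ?P"
    using assms(3,4) \<open>?I \<noteq> {}\<close> finite_Collect_less_nat[of n]
    unfolding finite_product_closed_def by metis
  \<comment> \<open>Evaluates all homomorphisms of \<open>E\<close> at once; the outer restriction
    puts the tuple into the extensional carrier of the product.\<close>
  define \<theta> where "\<theta> = (\<lambda>x. \<lambda>i\<in>?I. e i x)"
  have e_hom: "e i \<in> hom G F" if "i < n" for i using e that by (auto simp: E_def)
  have "\<theta> \<in> hom G ?P"
    using hom_mult[OF e_hom] hom_in_carrier[OF e_hom]
    by (auto simp: \<theta>_def hom_def product_group_def intro!: restrict_ext)
  then have \<theta>: "group_hom G ?P \<theta>"
    using P assms(5) by (simp add: group_hom_def group_hom_axioms_def in_class_def)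
  have "kernel G ?P \<theta> = hom_core G F"
  proof (intro subset_antisym subsetI)
    fix x assume x: "x \<in> kernel G ?P \<theta>"
    then have xc: "x \<in> carrier G" by (simp add: kernel_def)
    have eq: "\<theta> x = (\<lambda>i\<in>?I. \<one>\<^bsub>F\<^esub>)" using x by (simp add: kernel_def product_group_def)
    have "f x = \<one>\<^bsub>F\<^esub>" if f: "f \<in> hom G F" for f
    proof -
      \<comment> \<open>An arbitrary \<open>f\<close> agrees on the carrier with its restriction,
        which is one of the coordinates of \<open>\<theta>\<close>.\<close>
      obtain i where i: "i < n" "restrict f (carrier G) = e i" using restr[OF f] e by auto
      have "f x = e i x" using xc by (simp flip: i(2))
      then show ?thesis using fun_cong[OF eq, of i] i(1) by (simp add: \<theta>_def)
    qed
    then show "x \<in> hom_core G F" using xc by (simp add: hom_core_def)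
  next
    fix x assume "x \<in> hom_core G F"
    then show "x \<in> kernel G ?P \<theta>"
      using e_hom by (auto simp: hom_core_def kernel_def product_group_def \<theta>_def intro!: restrict_ext)
  qed
  then show ?thesis using in_class_factor_kernel[OF assms(1,2) P \<theta>] by simp
qed

text \<open>If the induced map is conjugation by the coset of \<open>h\<close>, then
  \<open>\<phi> g\<close> equals the conjugate of \<open>g\<close> by \<open>h\<close> up to a
  factor \<open>k\<close> in \<open>K\<close>. Since \<open>\<pi>\<close> kills \<open>k\<close>,
  the element \<open>\<pi> h\<close> conjugates \<open>\<pi> g\<close> to
  \<open>\<pi> (\<phi> g)\<close>.\<close>

lemma conjugate_in_if_induced_inner:
  assumes "group G" "group F" "\<pi> \<in> hom G F" "g \<in> carrier G"
    and "characteristic_subgroup K G" "K \<subseteq> kernel G F \<pi>" "\<phi> \<in> auto G"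
    and "induced_aut G K \<phi> \<in> Inn (G Mod K)"
  shows "conjugate_in F (\<pi> g) (\<pi> (\<phi> g))"
proof -
  interpret G: group G by fact
  interpret \<pi>: group_hom G F \<pi> using assms by (simp add: group_hom_def group_hom_axioms_def)
  have K: "K \<lhd> G" using G.characteristic_imp_normal[OF assms(5)] .
  interpret K: normal K G by fact
  have \<phi>g: "\<phi> g \<in> carrier G" using assms(4,7) by (auto simp: auto_def hom_def)
  let ?Q = "G Mod K"
  obtain A where A: "A \<in> carrier ?Q"
    and ind: "induced_aut G K \<phi> = (\<lambda>B\<in>carrier ?Q. A \<otimes>\<^bsub>?Q\<^esub> B \<otimes>\<^bsub>?Q\<^esub> inv\<^bsub>?Q\<^esub> A)"
    using assms(8) by (auto simp: Inn_def)
  obtain h where h: "h \<in> carrier G" "A = K #>\<^bsub>G\<^esub> h"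
    using A by (auto simp: FactGroup_def RCOSETS_def)
  have gK: "K #>\<^bsub>G\<^esub> g \<in> carrier (G Mod K)"
    using assms(4) by (auto simp: FactGroup_def RCOSETS_def)
  have "K #>\<^bsub>G\<^esub> \<phi> g = A \<otimes>\<^bsub>?Q\<^esub> (K #>\<^bsub>G\<^esub> g) \<otimes>\<^bsub>?Q\<^esub> inv\<^bsub>?Q\<^esub> A"
    using fun_cong[OF ind, of "K #>\<^bsub>G\<^esub> g"] gK G.induced_aut_coset[OF assms(5,7,4)] by simp
  also have "\<dots> = K #>\<^bsub>G\<^esub> (h \<otimes>\<^bsub>G\<^esub> g \<otimes>\<^bsub>G\<^esub> inv\<^bsub>G\<^esub> h)"
    using A h assms(4) by (simp add: K.inv_FactGroup K.rcos_inv K.rcos_sum)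
  finally have "\<phi> g \<in> K #>\<^bsub>G\<^esub> (h \<otimes>\<^bsub>G\<^esub> g \<otimes>\<^bsub>G\<^esub> inv\<^bsub>G\<^esub> h)"
    using G.rcos_self[OF \<phi>g K.subgroup_axioms] by simp
  then obtain k where k: "k \<in> K" "\<phi> g = k \<otimes>\<^bsub>G\<^esub> (h \<otimes>\<^bsub>G\<^esub> g \<otimes>\<^bsub>G\<^esub> inv\<^bsub>G\<^esub> h)"
    by (auto simp: r_coset_def)
  have "k \<in> carrier G" "\<pi> k = \<one>\<^bsub>F\<^esub>" using k(1) assms(6) by (auto simp: kernel_def)
  then have "\<pi> (\<phi> g) = \<pi> h \<otimes>\<^bsub>F\<^esub> \<pi> g \<otimes>\<^bsub>F\<^esub> inv\<^bsub>F\<^esub> \<pi> h"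
    using k(2) h(1) assms(4) by simp
  then show ?thesis using h(1) by (auto simp: conjugate_in_def)
qed

theorem corollary3p3:
  fixes \<C> :: "nat monoid set" and G :: "('a, 'b) monoid_scheme"
  assumes "finite_group_class \<C>"
    and "subgroup_closed \<C>"
    and "finite_product_closed \<C>"
    and "grossmanian \<C> G"
  shows "inner_aut_separable \<C> G"
  unfolding inner_aut_separable_def
proof
  fix \<phi> assume \<phi>: "\<phi> \<in> auto G - Inn G"
  have G: "group G" "finitely_generated_group G" "conjugacy_separable \<C> G" "grossman_property_A G"
    using assms(4) by (auto simp: grossmanian_def)
  obtain g where g: "g \<in> carrier G" "\<not> conjugate_in G (\<phi> g) g"
    using G(4) \<phi> unfolding grossman_property_A_def pointwise_inner_def by blast
  have \<phi>g: "\<phi> g \<in> carrier G" using \<phi> g(1) by (auto simp: auto_def hom_def)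
  obtain F \<pi> where F: "F \<in> \<C>" and \<pi>: "\<pi> \<in> hom G F" "\<not> conjugate_in F (\<pi> (\<phi> g)) (\<pi> g)"
    using G(3) g \<phi>g unfolding conjugacy_separable_def by blast
  have "group F" using F assms(1) by (simp add: finite_group_class_def)
  let ?K = "hom_core G F"
  have "induced_aut G ?K \<phi> \<notin> Inn (G Mod ?K)"
  proof
    assume "induced_aut G ?K \<phi> \<in> Inn (G Mod ?K)"
    moreover have "?K \<subseteq> kernel G F \<pi>" using \<pi>(1) by (auto simp: hom_core_def kernel_def)
    ultimately have "conjugate_in F (\<pi> g) (\<pi> (\<phi> g))"
      using conjugate_in_if_induced_inner[OF G(1) \<open>group F\<close> \<pi>(1) g(1)
          characteristic_hom_core[OF G(1) \<open>group F\<close>]] \<phi> by simp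
    \<comment> \<open>The conjugacy obtained runs from \<open>\<pi> g\<close> to
      \<open>\<pi> (\<phi> g)\<close>, the excluded one the other way, hence the appeal to
      symmetry.\<close>
    then show False
      using group.conjugate_in_sym[OF \<open>group F\<close>] \<pi>(2) hom_in_carrier[OF \<pi>(1) g(1)] by simp
  qed
  then show "\<exists>K. characteristic_subgroup K G \<and> in_class \<C> (G Mod K) \<and>
      induced_aut G K \<phi> \<notin> Inn (G Mod K)"
    using characteristic_hom_core[OF G(1) \<open>group F\<close>] in_class_factor_hom_core[OF assms(1-3) F G(1,2)]
    by blast
qed

end
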